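(* Let $g\in\mathfrak F_*$ and assume that $g$ has the strong natural-measure property (SNM). Let $\mathcal D\subset C(I)$ be countable and uniformly dense. Suppose that for every $\phi\in\mathcal D$ there are constants $C_\phi<\infty$ and $\delta_\phi>0$ such that $$\sum_{0\le i,j<n}\left|\operatorname{Cov}_m\bigl(\phi\circ g^{2^i},\phi\circ g^{2^j}\bigr)\right|\le C_\phi n^{2-\delta_\phi}\qquad\text{for all }n\ge1.$$ Then, for $m$-almost every $x\in I$, $$\mu_n^{\mathrm{dyad}}(x)=\frac1n\sum_{k=0}^{n-1}\delta_{g^{2^k}x}\longrightarrow\nu_*\quad\text{weak-star as }n\to\infty,$$ and hence $m(X_{\mathrm{dyad}})=0$, where $X_{\mathrm{dyad}}=\{x\in I:\mu_n^{\mathrm{dyad}}(x)\text{ does not converge weak-star}\}$.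
   Context: $C(I)$ is the space of real-valued continuous functions on $I=[-1,1]$, and for bounded measurable $F,H$ on $I$, $\operatorname{Cov}_m(F,H)=\int_I FH\,dm-\left(\int_IF\,dm\right)\left(\int_IH\,dm\right)$. Strong natural-measure property (SNM) of $g$: for every Borel probability measure $\lambda\ll m$ on $I$, $(g^n)_*\lambda\to\nu_*$ weak-star as $n\to\infty$, where $\nu_*$ is defined below. The class $\mathfrak F_*$. Let $I=[-1,1]$, $I_-=[-1,0]$, $I_+=[0,1]$, and let $m$ be normalized Lebesgue measure on $I$. For a map $g:I\to I$ write $g_-,g_+$ for its branches on $(-1,0)$ and $(0,1)$, and also for their one-sided continuous extensions (so $g_-(0)=1$, $g_+(0)=-1$); the value $g(0)$ is by convention one of these two branch values. Then $g\in\mathfrak F_*$ if the following hold. (A0) $g_-:(-1,0)\to(-1,1)$ and $g_+:(0,1)\to(-1,1)$ are orientation-preserving $C^2$ diffeomorphisms, and the only fixed points of $g$ are $-1$ and $1$. (A1) There are constants $\ell_-,\ell_+,\iota,k_-,k_+,a_-,a_+,b_-,b_+>0$ such that, with $U_{0-}=(-\iota,0]$, $U_{0+}=[0,\iota)$, $U_{-1}=g_+(U_{0+})$, $U_{+1}=g_-(U_{0-})$: $g_-(x)=x+b_-(1+x)^{1+\ell_-}$ on $U_{-1}$ and $g_+(x)=x-b_+(1-x)^{1+\ell_+}$ on $U_{+1}$; if $k_-\ne1$ then $g_-(x)=1-a_-|x|^{k_-}$ on $U_{0-}$; if $k_+\ne1$ then $g_+(x)=-1+a_+x^{k_+}$ on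 $U_{0+}$. If $k_-=1$ (resp. $k_+=1$), the corresponding formula is replaced by the requirement that the one-sided derivative satisfies $g'(0-)=a_->1$ (resp. $g'(0+)=a_+>1$), together with monotonicity on the corresponding one-sided neighborhood. (A2) Let $\Delta_0^-=g_-^{-1}((0,1))$, $\Delta_0^+=g_+^{-1}((-1,0))$, and for $n\ge1$ let $\Delta_n^\pm=g_\pm^{-1}(\Delta_{n-1}^\pm)$, $\delta_n^-=g_-^{-1}(\Delta_{n-1}^+)\cap\Delta_0^-$, $\delta_n^+=g_+^{-1}(\Delta_{n-1}^-)\cap\Delta_0^+$. Put $n_\pm=0$ if $\Delta_0^\pm\subset U_{0\pm}$, and otherwise $n_\pm=\min\{n\ge1:\delta_n^\pm\subset U_{0\pm}\}$. There is $\lambda_A>1$ such that, for either sign, $(g^n)'(x)>\lambda_A$ for all $1\le n\le n_\pm$ and $x\in\delta_n^\pm$ (empty requirement if $n_\pm=0$). (Balance) With $\beta^-=\ell_-k_+$, $\beta^+=\ell_+k_-$, one has $\beta^-=\beta^+=:\beta\ge1$. Put $\alpha=1/\beta\in(0,1]$. The measure $\nu_*$. Let $\varphi(u)=\min\{n\ge1:g^nu\in\Delta_0^-\}$ and $G(u)=g^{\varphi(u)}(u)$ be the first-return time and first-return map to $\Delta_0^-$ (defined Lebesgue-a.e. on $\Delta_0^-$). It is known that $G$ is a full-branch Gibbs--Markov map with a unique invariant probability $\widehat\mu$ on $\Delta_0^-$ absolutely continuous with respect to (in fact equivalent to) Lebesgue. Let $\tau^+(u)=\#\{1\le r\le\varphi(u):g^ru\in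 I_+\}$ and $\tau^-(u)=\#\{1\le r\le\varphi(u):g^ru\in I_-\}$. It is known that there are constants $C_+,C_->0$ with $\widehat\mu(\tau^\pm>n)\sim C_\pm n^{-\alpha}$. Put $p_*=C_+/(C_++C_-)$ and $\nu_*=p_*\delta_1+(1-p_* )\delta_{-1}$. *)

theory Defs
  imports "HOL-Probability.Probability" "HOL-Real_Asymp.Real_Asymp"
begin

abbreviation (input) int_I :: "real set" where "int_I \<equiv> {-1..1}"
abbreviation (input) int_I_minus :: "real set" where "int_I_minus \<equiv> {-1..0}"
abbreviation (input) int_I_plus :: "real set" where "int_I_plus \<equiv> {0..1}"

text \<open>Measures on \<open>I\<close> live on the space \<open>I\<close> itself, because a map \<open>g : I \<rightarrow> I\<close> is represented by a
  total function on the reals whose values outside \<open>I\<close> are arbitrary.\<close>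

definition borel_I :: "real measure" where
  "borel_I = restrict_space borel int_I"

definition leb_I :: "real measure" where
  "leb_I = uniform_measure (restrict_space lborel int_I) int_I"

definition C_I :: "(real \<Rightarrow> real) set" where
  "C_I = {f. continuous_on int_I f}"

definition uniformly_dense :: "(real \<Rightarrow> real) set \<Rightarrow> bool" where
  "uniformly_dense D \<longleftrightarrow> (\<forall>f\<in>C_I. \<forall>e>0. \<exists>d\<in>D. \<forall>x\<in>int_I. \<bar>f x - d x\<bar> < e)"

definition Cov_I :: "(real \<Rightarrow> real) \<Rightarrow> (real \<Rightarrow> real) \<Rightarrow> real" where
  "Cov_I F H = (\<integral>x. F x * H x \<partial>leb_I) - (\<integral>x. F x \<partial>leb_I) * (\<integral>x. H x \<partial>leb_I)"

definition weak_star_conv :: "(nat \<Rightarrow> real measure) \<Rightarrow> real measure \<Rightarrow> bool" where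
  "weak_star_conv \<mu> \<nu> \<longleftrightarrow> (\<forall>f\<in>C_I. (\<lambda>n. \<integral>x. f x \<partial>\<mu> n) \<longlonglongrightarrow> (\<integral>x. f x \<partial>\<nu>))"


definition C2_on :: "real set \<Rightarrow> (real \<Rightarrow> real) \<Rightarrow> bool" where
  "C2_on S f \<longleftrightarrow> (\<forall>x\<in>S. f differentiable (at x)) \<and> deriv f C1_differentiable_on S"

definition C2_diffeo :: "(real \<Rightarrow> real) \<Rightarrow> real set \<Rightarrow> real set \<Rightarrow> bool" where
  "C2_diffeo f S T \<longleftrightarrow>
     open S \<and> open T \<and> bij_betw f S T \<and> C2_on S f \<and> C2_on T (the_inv_into S f)"

definition orientation_preserving_on :: "real set \<Rightarrow> (real \<Rightarrow> real) \<Rightarrow> bool" where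
  "orientation_preserving_on S f \<longleftrightarrow> (\<forall>x\<in>S. 0 < deriv f x)"

text \<open>The branches of \<open>g\<close> on \<open>[-1,0]\<close> and \<open>[0,1]\<close>, with their one-sided limits at \<open>0\<close>; at the outer
  endpoints, \<open>g (-1) = -1\<close> and \<open>g 1 = 1\<close> are already the continuous extensions.\<close>

definition br_minus :: "(real \<Rightarrow> real) \<Rightarrow> real \<Rightarrow> real" where
  "br_minus g x = (if x = 0 then 1 else g x)"

definition br_plus :: "(real \<Rightarrow> real) \<Rightarrow> real \<Rightarrow> real" where
  "br_plus g x = (if x = 0 then -1 else g x)"

definition cond_A0 :: "(real \<Rightarrow> real) \<Rightarrow> bool" where
  "cond_A0 g \<longleftrightarrow>
     g ` int_I \<subseteq> int_I \<and> g 0 \<in> {br_minus g 0, br_plus g 0} \<and>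
     C2_diffeo g {-1<..<0} {-1<..<1} \<and> orientation_preserving_on {-1<..<0} g \<and>
     C2_diffeo g {0<..<1} {-1<..<1} \<and> orientation_preserving_on {0<..<1} g \<and>
     {x \<in> int_I. g x = x} = {-1, 1}"

definition U0_minus :: "real \<Rightarrow> real set" where "U0_minus \<iota> = {-\<iota><..0}"
definition U0_plus :: "real \<Rightarrow> real set" where "U0_plus \<iota> = {0..<\<iota>}"
definition Um1 :: "(real \<Rightarrow> real) \<Rightarrow> real \<Rightarrow> real set" where "Um1 g \<iota> = br_plus g ` U0_plus \<iota>"
definition Up1 :: "(real \<Rightarrow> real) \<Rightarrow> real \<Rightarrow> real set" where "Up1 g \<iota> = br_minus g ` U0_minus \<iota>"

text \<open>The four inclusions say that each neighbourhood lies in the domain of the branch for which a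
  formula is required there.\<close>

definition cond_A1 :: "(real \<Rightarrow> real) \<Rightarrow> real \<Rightarrow> real \<Rightarrow> real \<Rightarrow> real \<Rightarrow> real \<Rightarrow>
    real \<Rightarrow> real \<Rightarrow> real \<Rightarrow> real \<Rightarrow> bool" where
  "cond_A1 g \<iota> lm lp km kp am ap bm bp \<longleftrightarrow>
     \<iota> > 0 \<and> lm > 0 \<and> lp > 0 \<and> km > 0 \<and> kp > 0 \<and> am > 0 \<and> ap > 0 \<and> bm > 0 \<and> bp > 0 \<and>
     U0_minus \<iota> \<subseteq> int_I_minus \<and> U0_plus \<iota> \<subseteq> int_I_plus \<and>
     Um1 g \<iota> \<subseteq> int_I_minus \<and> Up1 g \<iota> \<subseteq> int_I_plus \<and>
     (\<forall>x\<in>Um1 g \<iota>. br_minus g x = x + bm * (1 + x) powr (1 + lm)) \<and>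
     (\<forall>x\<in>Up1 g \<iota>. br_plus g x = x - bp * (1 - x) powr (1 + lp)) \<and>
     (if km \<noteq> 1 then \<forall>x\<in>U0_minus \<iota>. br_minus g x = 1 - am * \<bar>x\<bar> powr km
      else (br_minus g has_real_derivative am) (at_left 0) \<and> am > 1 \<and>
           mono_on (U0_minus \<iota>) (br_minus g)) \<and>
     (if kp \<noteq> 1 then \<forall>x\<in>U0_plus \<iota>. br_plus g x = -1 + ap * x powr kp
      else (br_plus g has_real_derivative ap) (at_right 0) \<and> ap > 1 \<and>
           mono_on (U0_plus \<iota>) (br_plus g))"

text \<open>As \<open>(0,1)\<close>, \<open>(-1,0)\<close> and all the \<open>\<Delta>\<close> sets avoid \<open>-1\<close>, \<open>0\<close> and \<open>1\<close>, preimages under a branch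
  may be taken in the open intervals.\<close>

fun Delta_minus :: "(real \<Rightarrow> real) \<Rightarrow> nat \<Rightarrow> real set" where
  "Delta_minus g 0 = {x \<in> {-1<..<0}. g x \<in> {0<..<1}}"
| "Delta_minus g (Suc n) = {x \<in> {-1<..<0}. g x \<in> Delta_minus g n}"

fun Delta_plus :: "(real \<Rightarrow> real) \<Rightarrow> nat \<Rightarrow> real set" where
  "Delta_plus g 0 = {x \<in> {0<..<1}. g x \<in> {-1<..<0}}"
| "Delta_plus g (Suc n) = {x \<in> {0<..<1}. g x \<in> Delta_plus g n}"

text \<open>Used for \<open>n \<ge> 1\<close> only.\<close>

definition delta_minus :: "(real \<Rightarrow> real) \<Rightarrow> nat \<Rightarrow> real set" where
  "delta_minus g n = {x \<in> {-1<..<0}. g x \<in> Delta_plus g (n - 1)} \<inter> Delta_minus g 0"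

definition delta_plus :: "(real \<Rightarrow> real) \<Rightarrow> nat \<Rightarrow> real set" where
  "delta_plus g n = {x \<in> {0<..<1}. g x \<in> Delta_minus g (n - 1)} \<inter> Delta_plus g 0"

definition n_minus :: "(real \<Rightarrow> real) \<Rightarrow> real \<Rightarrow> nat" where
  "n_minus g \<iota> = (if Delta_minus g 0 \<subseteq> U0_minus \<iota> then 0
                   else LEAST n. n \<ge> 1 \<and> delta_minus g n \<subseteq> U0_minus \<iota>)"

definition n_plus :: "(real \<Rightarrow> real) \<Rightarrow> real \<Rightarrow> nat" where
  "n_plus g \<iota> = (if Delta_plus g 0 \<subseteq> U0_plus \<iota> then 0
                  else LEAST n. n \<ge> 1 \<and> delta_plus g n \<subseteq> U0_plus \<iota>)"

definition cond_A2 :: "(real \<Rightarrow> real) \<Rightarrow> real \<Rightarrow> bool" where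
  "cond_A2 g \<iota> \<longleftrightarrow> (\<exists>c>1.
     (\<forall>n\<in>{1..n_minus g \<iota>}. \<forall>x\<in>delta_minus g n. deriv (g ^^ n) x > c) \<and>
     (\<forall>n\<in>{1..n_plus g \<iota>}. \<forall>x\<in>delta_plus g n. deriv (g ^^ n) x > c))"

definition F_star_exponents :: "(real \<Rightarrow> real) \<Rightarrow> real \<Rightarrow> real \<Rightarrow> real \<Rightarrow> real \<Rightarrow> bool" where
  "F_star_exponents g lm lp km kp \<longleftrightarrow>
     cond_A0 g \<and>
     (\<exists>\<iota> am ap bm bp. cond_A1 g \<iota> lm lp km kp am ap bm bp \<and> cond_A2 g \<iota>) \<and>
     lm * kp = lp * km \<and> lm * kp \<ge> 1"

definition F_star :: "(real \<Rightarrow> real) set" where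
  "F_star = {g. \<exists>lm lp km kp. F_star_exponents g lm lp km kp}"

text \<open>The exponents are determined by the germs of \<open>g\<close> at \<open>-1\<close>, \<open>0\<close> and \<open>1\<close>, so \<open>\<beta>\<close> depends on \<open>g\<close>
  alone; see \<open>beta_F_star\<close> below.\<close>

definition beta_F :: "(real \<Rightarrow> real) \<Rightarrow> real" where
  "beta_F g = (THE b. \<exists>lm lp km kp. F_star_exponents g lm lp km kp \<and> b = lm * kp)"

lemma powr_germ_unique:
  fixes a b c p q :: real
  assumes "a > 0" "b > 0" "c > 0" and eq: "\<And>t. 0 < t \<Longrightarrow> t < c \<Longrightarrow> a * t powr p = b * t powr q"
  shows "p = q"
proof -
  define s where "s = c / 4"
  have s: "s > 0" "2 * s < c" using assms(3) by (auto simp: s_def)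
  have 1: "a * s powr p = b * s powr q" using s by (intro eq) auto
  have "a * (2 * s) powr p = b * (2 * s) powr q" using s by (intro eq) auto
  then have "a * s powr p * 2 powr p = b * s powr q * 2 powr q"
    using s by (simp add: powr_mult mult_ac)
  then have "a * s powr p * 2 powr p = a * s powr p * 2 powr q" by (simp add: 1)
  moreover have "a * s powr p > 0" using assms(1) s by simp
  ultimately have "(2::real) powr p = 2 powr q" by (metis mult_left_cancel less_irrefl)
  then show ?thesis by (simp add: powr_inj)
qed

lemma powr_germ_no_slope:
  fixes f :: "real \<Rightarrow> real"
  assumes "\<iota> > 0" "b > 0" "k > 0" "k \<noteq> 1" "a > 0"
    and f: "\<And>x. 0 \<le> x \<Longrightarrow> x < \<iota> \<Longrightarrow> f x = -1 + b * x powr k"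
    and d: "(f has_real_derivative a) (at_right 0)"
  shows False
proof -
  have "((\<lambda>x. (f x - f 0) / (x - 0)) \<longlongrightarrow> a) (at_right 0)"
    using d by (simp add: has_field_derivative_iff)
  moreover have "eventually (\<lambda>x. (f x - f 0) / (x - 0) = b * x powr (k - 1)) (at_right 0)"
    using eventually_at_right_real[OF assms(1)]
  proof eventually_elim
    case (elim x)
    then have "f x = -1 + b * x powr k" "f 0 = -1" using f[of x] f[of 0] assms by auto
    then show ?case using elim by (simp add: powr_diff)
  qed
  ultimately have lim: "((\<lambda>x. b * x powr (k - 1)) \<longlongrightarrow> a) (at_right 0)"
    by (simp add: filterlim_cong)
  show False
  proof (cases "k > 1")
    case True
    then have "((\<lambda>x. b * x powr (k - 1)) \<longlongrightarrow> b * 0) (at_right 0)"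
      using assms by (intro tendsto_intros) real_asymp
    then show False using tendsto_unique[OF _ lim] assms(5) by force
  next
    case False
    then have "filterlim (\<lambda>x. b * x powr (k - 1)) at_top (at_right 0)"
      using assms by real_asymp
    then show False
      using not_tendsto_and_filterlim_at_infinity[OF _ lim] filterlim_at_top_imp_at_infinity
      by force
  qed
qed

lemma Um1_germ:
  assumes A0: "cond_A0 g" and "\<iota> > 0" "U0_plus \<iota> \<subseteq> {0..1}"
  shows "\<exists>e>0. \<forall>t. 0 < t \<and> t < e \<longrightarrow> -1 + t \<in> Um1 g \<iota>"
proof -
  let ?c = "\<iota> / 2"
  have le1: "?c < 1" using assms(2) subsetD[OF assms(3), of "?c"] subsetD[OF assms(3), of "3 * \<iota> / 4"]
    by (auto simp: U0_plus_def)
  have bij: "bij_betw g {0<..<1} {-1<..<1}"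
    using A0 by (simp add: cond_A0_def C2_diffeo_def)
  have pos: "\<exists>y. (g has_real_derivative y) (at x) \<and> y > 0" if "0 < x" "x < 1" for x
    using that A0 DERIV_deriv_iff_real_differentiable[of g x]
    by (auto simp: cond_A0_def C2_diffeo_def C2_on_def orientation_preserving_on_def
        intro!: exI[of _ "deriv g x"])
  have mono: "g x < g y" if "0 < x" "x < y" "y < 1" for x y
    using that by (intro DERIV_pos_imp_increasing[of x y g]) (auto intro: pos)
  have gc: "g ?c \<in> {-1<..<1}" using bij_betwE[OF bij] assms(2) le1 by auto
  show ?thesis
  proof (intro exI[of _ "g ?c + 1"] conjI allI impI)
    show "g ?c + 1 > 0" using gc by simp
    fix t assume t: "0 < t \<and> t < g ?c + 1"
    then have "-1 + t \<in> g ` {0<..<1}" using gc bij by (auto simp: bij_betw_def)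
    then obtain x where x: "x \<in> {0<..<1}" "-1 + t = g x" by auto
    have "x < ?c"
    proof (rule ccontr)
      assume "\<not> x < ?c"
      then have "g ?c \<le> g x" using mono[of ?c x] x assms(2) by (cases "x = ?c") auto
      then show False using t x by auto
    qed
    then show "-1 + t \<in> Um1 g \<iota>" using x assms(2)
      by (auto simp: Um1_def U0_plus_def br_plus_def intro!: image_eqI[of _ _ x])
  qed
qed

lemma F_star_exponents_unique:
  assumes "F_star_exponents g lm lp km kp" "F_star_exponents g lm' lp' km' kp'"
  shows "lm = lm'" "kp = kp'"
proof -
  obtain \<iota> am ap bm bp where 1: "cond_A1 g \<iota> lm lp km kp am ap bm bp"
    using assms(1) by (auto simp: F_star_exponents_def)
  obtain \<iota>' am' ap' bm' bp' where 2: "cond_A1 g \<iota>' lm' lp' km' kp' am' ap' bm' bp'"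
    using assms(2) by (auto simp: F_star_exponents_def)
  have A0: "cond_A0 g" using assms(1) by (simp add: F_star_exponents_def)
  have p1: "\<iota> > 0" "lm > 0" "kp > 0" "ap > 0" "bm > 0" "U0_plus \<iota> \<subseteq> {0..1}"
    and f1: "\<And>x. x \<in> Um1 g \<iota> \<Longrightarrow> br_minus g x = x + bm * (1 + x) powr (1 + lm)"
    using 1 by (auto simp: cond_A1_def)
  have p2: "\<iota>' > 0" "lm' > 0" "kp' > 0" "ap' > 0" "bm' > 0" "U0_plus \<iota>' \<subseteq> {0..1}"
    and f2: "\<And>x. x \<in> Um1 g \<iota>' \<Longrightarrow> br_minus g x = x + bm' * (1 + x) powr (1 + lm')"
    using 2 by (auto simp: cond_A1_def)
  obtain e where e: "e > 0" "\<And>t. 0 < t \<Longrightarrow> t < e \<Longrightarrow> -1 + t \<in> Um1 g \<iota>"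
    using Um1_germ[OF A0 p1(1,6)] by auto
  obtain e' where e': "e' > 0" "\<And>t. 0 < t \<Longrightarrow> t < e' \<Longrightarrow> -1 + t \<in> Um1 g \<iota>'"
    using Um1_germ[OF A0 p2(1,6)] by auto
  have "1 + lm = 1 + lm'"
  proof (rule powr_germ_unique[of bm bm' "min e e'"])
    fix t assume t: "0 < t" "t < min e e'"
    show "bm * t powr (1 + lm) = bm' * t powr (1 + lm')"
      using f1[OF e(2)[of t]] f2[OF e'(2)[of t]] t by simp
  qed (use p1 p2 e e' in auto)
  then show "lm = lm'" by simp
  have k1: "if kp \<noteq> 1 then \<forall>x. 0 \<le> x \<longrightarrow> x < \<iota> \<longrightarrow> br_plus g x = -1 + ap * x powr kp
      else (br_plus g has_real_derivative ap) (at_right 0)"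
    using 1 by (auto simp: cond_A1_def U0_plus_def split: if_splits)
  have k2: "if kp' \<noteq> 1 then \<forall>x. 0 \<le> x \<longrightarrow> x < \<iota>' \<longrightarrow> br_plus g x = -1 + ap' * x powr kp'
      else (br_plus g has_real_derivative ap') (at_right 0)"
    using 2 by (auto simp: cond_A1_def U0_plus_def split: if_splits)
  show "kp = kp'"
  proof (cases "kp = 1"; cases "kp' = 1")
    assume "kp = 1" "kp' \<noteq> 1"
    then show ?thesis
      using powr_germ_no_slope[of \<iota>' ap' kp' ap "br_plus g"] k1 k2 p1 p2 by auto
  next
    assume "kp \<noteq> 1" "kp' = 1"
    then show ?thesis
      using powr_germ_no_slope[of \<iota> ap kp ap' "br_plus g"] k1 k2 p1 p2 by auto
  next
    assume *: "kp \<noteq> 1" "kp' \<noteq> 1"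
    show ?thesis
    proof (rule powr_germ_unique[of ap ap' "min \<iota> \<iota>'"])
      fix t assume t: "0 < t" "t < min \<iota> \<iota>'"
      have "br_plus g t = -1 + ap * t powr kp" using k1 * t by auto
      moreover have "br_plus g t = -1 + ap' * t powr kp'" using k2 * t by auto
      ultimately show "ap * t powr kp = ap' * t powr kp'" by simp
    qed (use p1 p2 in auto)
  qed simp
qed

lemma beta_F_star:
  assumes "F_star_exponents g lm lp km kp"
  shows "beta_F g = lm * kp"
  unfolding beta_F_def
  using assms F_star_exponents_unique[OF assms] by (intro the_equality) blast+

definition alpha_F :: "(real \<Rightarrow> real) \<Rightarrow> real" where
  "alpha_F g = 1 / beta_F g"


definition return_time :: "(real \<Rightarrow> real) \<Rightarrow> real \<Rightarrow> nat" where
  "return_time g u = (LEAST n. n \<ge> 1 \<and> (g ^^ n) u \<in> Delta_minus g 0)"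

definition return_map :: "(real \<Rightarrow> real) \<Rightarrow> real \<Rightarrow> real" where
  "return_map g u = (g ^^ return_time g u) u"

text \<open>The invariance condition uses preimages directly, since the return map is only defined
  almost everywhere and need not send the exceptional null set into \<open>\<Delta>\<^sub>0\<^sup>-\<close>.\<close>

definition is_acip :: "(real \<Rightarrow> real) \<Rightarrow> real measure \<Rightarrow> bool" where
  "is_acip g \<mu> \<longleftrightarrow>
     prob_space \<mu> \<and> sets \<mu> = sets (restrict_space borel (Delta_minus g 0)) \<and>
     absolutely_continuous (restrict_space lborel (Delta_minus g 0)) \<mu> \<and>
     (\<forall>A\<in>sets \<mu>. return_map g -` A \<inter> space \<mu> \<in> sets \<mu> \<and>
        emeasure \<mu> (return_map g -` A \<inter> space \<mu>) = emeasure \<mu> A)"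

definition mu_hat :: "(real \<Rightarrow> real) \<Rightarrow> real measure" where
  "mu_hat g = (THE \<mu>. is_acip g \<mu>)"

definition tau_plus :: "(real \<Rightarrow> real) \<Rightarrow> real \<Rightarrow> nat" where
  "tau_plus g u = card {r\<in>{1..return_time g u}. (g ^^ r) u \<in> int_I_plus}"

definition tau_minus :: "(real \<Rightarrow> real) \<Rightarrow> real \<Rightarrow> nat" where
  "tau_minus g u = card {r\<in>{1..return_time g u}. (g ^^ r) u \<in> int_I_minus}"

definition tail_const :: "(real \<Rightarrow> real) \<Rightarrow> (real \<Rightarrow> nat) \<Rightarrow> real" where
  "tail_const g \<tau> = (THE C. C > 0 \<and>
     (\<lambda>n. measure (mu_hat g) {u \<in> Delta_minus g 0. \<tau> u > n})
       \<sim>[at_top] (\<lambda>n. C * real n powr (- alpha_F g)))"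

definition p_star :: "(real \<Rightarrow> real) \<Rightarrow> real" where
  "p_star g = tail_const g (tau_plus g) /
     (tail_const g (tau_plus g) + tail_const g (tau_minus g))"

text \<open>The measure \<open>p\<^sub>* \<delta>\<^sub>1 + (1 - p\<^sub>*) \<delta>\<^sub>-\<^sub>1\<close>.\<close>

definition nu_star :: "(real \<Rightarrow> real) \<Rightarrow> real measure" where
  "nu_star g = distr (measure_pmf (bernoulli_pmf (p_star g))) borel_I (\<lambda>b. if b then 1 else -1)"

definition SNM :: "(real \<Rightarrow> real) \<Rightarrow> bool" where
  "SNM g \<longleftrightarrow> (\<forall>\<kappa>. prob_space \<kappa> \<and> sets \<kappa> = sets borel_I \<and> absolutely_continuous leb_I \<kappa> \<longrightarrow>
     weak_star_conv (\<lambda>n. distr \<kappa> borel_I (g ^^ n)) (nu_star g))"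


text \<open>The average of the Dirac masses at \<open>g\<^bsup>2^k\<^esup> x\<close>, \<open>k < n\<close>, as the image of the uniform
  distribution on \<open>{..<n}\<close>.\<close>

definition mu_dyad :: "(real \<Rightarrow> real) \<Rightarrow> real \<Rightarrow> nat \<Rightarrow> real measure" where
  "mu_dyad g x n = distr (uniform_count_measure {..<n}) borel_I (\<lambda>k. (g ^^ (2 ^ k)) x)"

definition X_dyad :: "(real \<Rightarrow> real) \<Rightarrow> real set" where
  "X_dyad g = {x \<in> int_I. \<not> (\<exists>\<nu>. prob_space \<nu> \<and> sets \<nu> = sets borel_I \<and>
                                weak_star_conv (mu_dyad g x) \<nu>)}"

lemma integral_mu_dyad:
  assumes "f \<in> C_I" "g ` {-1..1} \<subseteq> {-1..1}" "x \<in> {-1..1}"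
  shows "(\<integral>y. f y \<partial>mu_dyad g x n) = (\<Sum>k<n. f ((g ^^ (2 ^ k)) x)) / n"
proof -
  have orb: "(g ^^ k) x \<in> {-1..1}" for k
    using assms(2,3) by (induction k) (auto simp: image_subset_iff simp del: atLeastAtMost_iff)
  have "(\<lambda>k. (g ^^ (2 ^ k)) x) \<in> uniform_count_measure {..<n} \<rightarrow>\<^sub>M borel_I"
    using orb by (auto simp: measurable_def borel_I_def space_restrict_space
        space_uniform_count_measure sets_uniform_count_measure)
  moreover have "f \<in> borel_measurable borel_I"
    using assms(1) unfolding borel_I_def C_I_def
    by (auto intro: borel_measurable_continuous_on_restrict)
  ultimately show ?thesis
    by (simp add: mu_dyad_def integral_distr integral_uniform_count_measure)
qed

end

theory Submission
  imports Defs
begin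

text \<open>The covariance hypothesis bounds the variance of the time average of \<open>\<phi> \<circ> g\<^bsup>2^k\<^esup>\<close> over
  \<open>k < n\<close> by \<open>C n\<^bsup>-\<delta>\<^esup>\<close>. Along \<open>n = j\<^bsup>p\<^esup>\<close> with \<open>p \<delta> \<ge> 2\<close> these variances are summable, so the
  centered averages tend to \<open>0\<close> almost everywhere; as \<open>((j + 1) / j)\<^bsup>p\<^esup> \<rightarrow> 1\<close> and the summands are
  bounded, the full sequence follows. The means converge to the integral of \<open>\<phi>\<close> against \<open>\<nu>\<^sub>*\<close> by
  SNM applied to \<open>m\<close> itself, and a countable dense set of \<open>\<phi>\<close> suffices for weak-star convergence.\<close>

section \<open>Cesaro averages and their control along p-th powers\<close>

lemma cesaro_mean_tendsto:
  fixes a :: "nat \<Rightarrow> real"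
  assumes "a \<longlonglongrightarrow> L"
  shows "(\<lambda>n. (\<Sum>k<n. a k) / real n) \<longlonglongrightarrow> L"
proof (rule LIMSEQ_I)
  fix r :: real assume "r > 0"
  then obtain N where N: "\<And>n. n \<ge> N \<Longrightarrow> \<bar>a n - L\<bar> < r / 2"
    using LIMSEQ_D[OF assms, of "r / 2"] by auto
  \<comment> \<open>\<open>K\<close> is the fixed total deviation of the first \<open>N\<close>
    terms; dividing by \<open>n\<close> makes it small, and every later term deviates by less than
    \<open>r / 2\<close>.\<close>
  define K where "K = (\<Sum>k<N. \<bar>a k - L\<bar>)"
  have "(\<lambda>n. K / real n) \<longlonglongrightarrow> 0" by real_asymp
  then obtain N' where N': "\<And>n. n \<ge> N' \<Longrightarrow> \<bar>K / real n\<bar> < r / 2"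
    using LIMSEQ_D[of "\<lambda>n. K / real n" 0 "r / 2"] \<open>r > 0\<close> by auto
  show "\<exists>no. \<forall>n\<ge>no. norm ((\<Sum>k<n. a k) / real n - L) < r"
  \<comment> \<open>\<open>Suc N\<close> rather than \<open>N\<close> guarantees n > 0, which the
    divisions by \<open>real n\<close> below rely on.\<close>
  proof (intro exI[of _ "max (Suc N) N'"] allI impI)
    fix n assume n: "n \<ge> max (Suc N) N'"
    have "{..<n} = {..<N} \<union> {N..<n}" using n by auto
    then have "(\<Sum>k<n. \<bar>a k - L\<bar>) = K + (\<Sum>k=N..<n. \<bar>a k - L\<bar>)"
      by (simp add: K_def sum.union_disjoint ivl_disj_int)
    also have "(\<Sum>k=N..<n. \<bar>a k - L\<bar>) \<le> (\<Sum>k=N..<n. r / 2)"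
      using N by (intro sum_mono) (auto intro: less_imp_le)
    also have "\<dots> \<le> real n * (r / 2)" using \<open>r > 0\<close> by (simp add: mult_right_mono)
    finally have "(\<Sum>k<n. \<bar>a k - L\<bar>) \<le> K + real n * (r / 2)" by simp
    with sum_abs[of "\<lambda>k. a k - L" "{..<n}"]
    have "\<bar>\<Sum>k<n. a k - L\<bar> / real n \<le> (K + real n * (r / 2)) / real n"
      by (intro divide_right_mono) linarith+
    moreover have "(\<Sum>k<n. a k) / real n - L = (\<Sum>k<n. a k - L) / real n"
      using n by (simp add: sum_subtractf field_simps)
    ultimately have "\<bar>(\<Sum>k<n. a k) / real n - L\<bar> \<le> (K + real n * (r / 2)) / real n"
      by simp
    also have "\<dots> = K / real n + r / 2" using n by (simp add: add_divide_distrib)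
    also have "\<dots> < r" using N'[of n] n abs_ge_self[of "K / real n"] by linarith
    finally show "norm ((\<Sum>k<n. a k) / real n - L) < r" by simp
  qed
qed

text \<open>Between consecutive p-th powers N \<le> n < N' the extra summands number at most N' - N,
  which is o(N), and each is bounded by \<open>B\<close>. So they cannot move the average away from
  its value at N.\<close>

lemma cesaro_zero_from_powers:
  fixes z :: "nat \<Rightarrow> real"
  assumes p: "p > 0" and bd: "\<And>k. \<bar>z k\<bar> \<le> B"
    and sub: "(\<lambda>j. (\<Sum>k<Suc j ^ p. z k) / real (Suc j ^ p)) \<longlonglongrightarrow> 0"
  shows "(\<lambda>n. (\<Sum>k<n. z k) / real n) \<longlonglongrightarrow> 0"
proof (rule LIMSEQ_I)
  fix r :: real assume "r > 0"
  have B: "B \<ge> 0" using bd[of 0] by linarith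
  \<comment> \<open>Chosen so that e (1 + B) = r / 2: one \<open>e\<close> for the average over the
    block of length N, and e B for the n - N leftover terms.\<close>
  define e where "e = r / (2 * (1 + B))"
  have e: "e > 0" using \<open>r > 0\<close> B by (simp add: e_def)
  \<comment> \<open>The p-th power of 1 + 1 / (j + 1) is the ratio of the consecutive block lengths
    (j + 2)^p and (j + 1)^p.\<close>
  have "(\<lambda>j. 1 + 1 / real (Suc j)) \<longlonglongrightarrow> 1" by real_asymp
  then have "(\<lambda>j. (1 + 1 / real (Suc j)) ^ p) \<longlonglongrightarrow> 1 ^ p" by (rule tendsto_power)
  then obtain J where J: "\<And>j. j \<ge> J \<Longrightarrow> \<bar>(1 + 1 / real (Suc j)) ^ p - 1\<bar> < e"
    using LIMSEQ_D[of "\<lambda>j. (1 + 1 / real (Suc j)) ^ p" 1 e] e by auto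
  obtain J' where J': "\<And>j. j \<ge> J' \<Longrightarrow> \<bar>(\<Sum>k<Suc j ^ p. z k) / real (Suc j ^ p)\<bar> < e"
    using LIMSEQ_D[OF sub e] by auto
  define K where "K = max J J'"
  show "\<exists>no. \<forall>n\<ge>no. norm ((\<Sum>k<n. z k) / real n - 0) < r"
  proof (intro exI[of _ "Suc K ^ p"] allI impI)
    fix n assume n: "n \<ge> Suc K ^ p"
    \<comment> \<open>The maximum \<open>j\<close> of \<open>A\<close> satisfies (j + 1)^p \<le> n <
      (j + 2)^p, and \<open>j \<ge> K\<close> puts it beyond both thresholds \<open>J\<close> and
      \<open>J'\<close>. Finiteness of \<open>A\<close> comes from j + 1 \<le> (j + 1)^p \<le>
      n.\<close>
    define A where "A = {j. j \<ge> K \<and> Suc j ^ p \<le> n}"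
    have "A \<subseteq> {..n}"
    proof
      fix j assume "j \<in> A"
      then have "Suc j ^ p \<le> n" by (simp add: A_def)
      moreover have "Suc j \<le> Suc j ^ p" using p by (intro self_le_power) auto
      ultimately show "j \<in> {..n}" by simp
    qed
    then have fin: "finite A" by (rule finite_subset) simp
    have "K \<in> A" using n by (simp add: A_def)
    define j where "j = Max A"
    have "j \<in> A" unfolding j_def using fin \<open>K \<in> A\<close> by (intro Max_in) auto
    then have j: "j \<ge> J" "j \<ge> J'" "Suc j ^ p \<le> n" by (auto simp: A_def K_def)
    have "Suc j \<notin> A" using Max_ge[OF fin, of "Suc j"] j_def by auto
    then have n_less: "n < Suc (Suc j) ^ p" using \<open>j \<in> A\<close> by (auto simp: A_def)
    define N where "N = Suc j ^ p"
    have N: "N > 0" "N \<le> n" using j by (simp_all add: N_def)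
    have "real (Suc (Suc j) ^ p) = real N * (1 + 1 / real (Suc j)) ^ p"
      by (simp add: N_def power_mult_distrib[symmetric] field_simps)
    then have "real n - real N \<le> real N * ((1 + 1 / real (Suc j)) ^ p - 1)"
      using of_nat_mono[where 'a = real, OF less_imp_le[OF n_less]]
      by (simp add: right_diff_distrib del: power_Suc of_nat_power)
    also have "\<dots> \<le> real N * e" using J[OF j(1)] by (intro mult_left_mono) auto
    finally have gap: "real n - real N \<le> real N * e" .
    have "{..<n} = {..<N} \<union> {N..<n}" using N by auto
    then have "(\<Sum>k<n. z k) = (\<Sum>k<N. z k) + (\<Sum>k=N..<n. z k)"
      by (simp add: sum.union_disjoint ivl_disj_int)
    moreover have "\<bar>\<Sum>k<N. z k\<bar> \<le> real N * e"
      using J'[OF j(2)] N by (simp add: N_def[symmetric] field_simps del: power_Suc)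
    moreover have "\<bar>\<Sum>k=N..<n. z k\<bar> \<le> (\<Sum>k=N..<n. B)"
      by (intro order_trans[OF sum_abs] sum_mono bd)
    moreover have "(\<Sum>k=N..<n. B) \<le> real N * e * B"
      using mult_right_mono[OF gap B] N by (simp add: of_nat_diff)
    ultimately have "\<bar>\<Sum>k<n. z k\<bar> \<le> real N * (e * (1 + B))" by (simp add: algebra_simps)
    also have "\<dots> \<le> real n * (e * (1 + B))" using N e B by (intro mult_right_mono) auto
    also have "e * (1 + B) = r / 2" using B by (simp add: e_def divide_simps)
    finally have "\<bar>(\<Sum>k<n. z k) / real n\<bar> \<le> r / 2" using N by (simp add: field_simps)
    then show "norm ((\<Sum>k<n. z k) / real n - 0) < r"
      using \<open>r > 0\<close> unfolding real_norm_def diff_0_right by linarith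
  qed
qed

section \<open>Almost everywhere convergence from covariance bounds\<close>

text \<open>By monotone convergence the sum of all \<open>f j\<close> has finite integral, so it is
  finite almost everywhere, and the terms of a convergent series tend to 0.\<close>

lemma AE_tendsto_zero_if_summable_integral:
  fixes f :: "nat \<Rightarrow> 'a \<Rightarrow> real"
  assumes int: "\<And>j. integrable M (f j)" and nonneg: "\<And>j x. 0 \<le> f j x"
    and bd: "\<And>j. (\<integral>x. f j x \<partial>M) \<le> c j" and c: "summable c"
  shows "AE x in M. (\<lambda>j. f j x) \<longlonglongrightarrow> 0"
proof -
  have [measurable]: "f j \<in> borel_measurable M" for j using int by auto
  have c0: "0 \<le> c j" for j by (rule order_trans[OF integral_nonneg_AE bd]) (simp add: nonneg)
  have "(\<integral>\<^sup>+x. (\<Sum>j. ennreal (f j x)) \<partial>M) = (\<Sum>j. \<integral>\<^sup>+x. ennreal (f j x) \<partial>M)"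
    by (intro nn_integral_suminf) measurable
  also have "\<dots> \<le> (\<Sum>j. ennreal (c j))"
    using bd nonneg int by (intro suminf_le) (auto simp: nn_integral_eq_integral intro!: ennreal_leI)
  also have "\<dots> = ennreal (\<Sum>j. c j)" using c c0 by (intro suminf_ennreal2) auto
  finally have "(\<integral>\<^sup>+x. (\<Sum>j. ennreal (f j x)) \<partial>M) \<noteq> \<infinity>" by (auto simp: top_unique)
  then have "AE x in M. (\<Sum>j. ennreal (f j x)) \<noteq> \<infinity>"
    by (intro nn_integral_PInf_AE) measurable
  then show ?thesis
  proof eventually_elim
    case (elim x)
    then have "summable (\<lambda>j. f j x)" using nonneg by (intro summable_suminf_not_top) auto
    then show ?case by (rule summable_LIMSEQ_zero)
  qed
qed

text \<open>The probabilistic core, free of dynamics: a strong law for bounded variables that may be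
  dependent and differently distributed, with only the sum of absolute covariances
  controlled.\<close>

lemma (in prob_space) AE_centered_means_tendsto_zero:
  fixes Y :: "nat \<Rightarrow> 'a \<Rightarrow> real"
  assumes Y[measurable]: "\<And>k. Y k \<in> borel_measurable M"
    and bd: "\<And>k x. x \<in> space M \<Longrightarrow> \<bar>Y k x\<bar> \<le> B"
    and \<delta>: "\<delta> > 0"
    and cov: "\<And>n. n \<ge> 1 \<Longrightarrow>
      (\<Sum>i<n. \<Sum>j<n. \<bar>expectation (\<lambda>x. Y i x * Y j x) - expectation (Y i) * expectation (Y j)\<bar>)
        \<le> C * real n powr (2 - \<delta>)"
  shows "AE x in M. (\<lambda>n. (\<Sum>k<n. Y k x - expectation (Y k)) / real n) \<longlonglongrightarrow> 0"
proof -
  define Z where "Z k x = Y k x - expectation (Y k)" for k x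
  have [measurable]: "Z k \<in> borel_measurable M" for k unfolding Z_def by measurable
  have intY: "integrable M (Y k)" for k
    using bd by (intro integrable_const_bound[of _ B]) auto
  have "0 \<le> B" using bd[of _ 0] not_empty by (metis abs_ge_zero ex_in_conv order_trans)
  have intYY: "integrable M (\<lambda>x. Y i x * Y j x)" for i j
    using bd \<open>0 \<le> B\<close> by (intro integrable_const_bound[of _ "B * B"]) (auto simp: abs_mult intro!: mult_mono)
  have intZZ: "integrable M (\<lambda>x. Z i x * Z j x)" for i j
    unfolding Z_def using intY intYY by (simp add: algebra_simps)
  have EZZ: "expectation (\<lambda>x. Z i x * Z j x)
      = expectation (\<lambda>x. Y i x * Y j x) - expectation (Y i) * expectation (Y j)" for i j
    unfolding Z_def using intY intYY by (simp add: algebra_simps prob_space)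
  have EYB: "\<bar>expectation (Y k)\<bar> \<le> B" for k
  proof -
    have "\<bar>expectation (Y k)\<bar> \<le> expectation (\<lambda>x. \<bar>Y k x\<bar>)" by (rule integral_abs_bound)
    also have "\<dots> \<le> expectation (\<lambda>x. B)" using intY bd by (intro integral_mono) auto
    finally show ?thesis by (simp add: prob_space)
  qed
  have Zb: "\<bar>Z k x\<bar> \<le> 2 * B" if "x \<in> space M" for k x
    using bd[OF that, of k] EYB[of k] by (simp add: Z_def)
  have sq: "(\<Sum>k<n. Z k x)\<^sup>2 = (\<Sum>i<n. \<Sum>j<n. Z i x * Z j x)" for n x
    by (simp add: power2_eq_square sum_product)
  have int2: "integrable M (\<lambda>x. (\<Sum>k<n. Z k x)\<^sup>2)" for n
    unfolding sq using intZZ by auto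
  have var: "expectation (\<lambda>x. (\<Sum>k<n. Z k x)\<^sup>2) \<le> C * real n powr (2 - \<delta>)" if "n \<ge> 1" for n
  proof -
    have "expectation (\<lambda>x. (\<Sum>k<n. Z k x)\<^sup>2) = (\<Sum>i<n. \<Sum>j<n. expectation (\<lambda>x. Z i x * Z j x))"
      unfolding sq using intZZ by simp
    also have "\<dots> \<le> (\<Sum>i<n. \<Sum>j<n. \<bar>expectation (\<lambda>x. Y i x * Y j x)
        - expectation (Y i) * expectation (Y j)\<bar>)"
      unfolding EZZ by (intro sum_mono abs_ge_self)
    also have "\<dots> \<le> C * real n powr (2 - \<delta>)" by (rule cov[OF that])
    finally show ?thesis .
  qed
  \<comment> \<open>At n = 1 the power of n is 1, so \<open>C\<close> itself bounds an absolute
    value.\<close>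
  have C: "C \<ge> 0"
    using cov[of 1] by simp
  \<comment> \<open>With N = (j + 1)^p the mean square of the average is at most C N^(-\<delta>) = C
    (j + 1)^(-p \<delta>); p \<delta> \<ge> 2 puts this below a summable inverse square.\<close>
  define p where "p = nat \<lceil>2 / \<delta>\<rceil>"
  have "real p \<ge> 2 / \<delta>" unfolding p_def by linarith
  then have p2: "real p * \<delta> \<ge> 2" using \<delta> by (simp add: field_simps)
  then have p: "p > 0" by (cases p) auto
  \<comment> \<open>Indexing by \<open>Suc j\<close> keeps the block length positive.\<close>
  define W where "W j x = ((\<Sum>k<Suc j ^ p. Z k x) / real (Suc j ^ p))\<^sup>2" for j x
  have "AE x in M. (\<lambda>j. W j x) \<longlonglongrightarrow> 0"
  proof (rule AE_tendsto_zero_if_summable_integral)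
    show "integrable M (W j)" for j
      unfolding W_def power_divide using int2 by auto
    show "0 \<le> W j x" for j x by (simp add: W_def)
    show "expectation (W j) \<le> C * inverse (real (Suc j) ^ 2)" for j
    proof -
      define q where "q = real (Suc j)"
      have q: "q \<ge> 1" by (simp add: q_def)
      have N: "real (Suc j ^ p) = q powr real p" using q by (simp add: q_def powr_realpow)
      have "expectation (W j) = expectation (\<lambda>x. (\<Sum>k<Suc j ^ p. Z k x)\<^sup>2) / (real (Suc j ^ p))\<^sup>2"
        unfolding W_def power_divide by simp
      also have "\<dots> \<le> C * real (Suc j ^ p) powr (2 - \<delta>) / (real (Suc j ^ p))\<^sup>2"
        by (intro divide_right_mono var) auto
      also have "\<dots> = C * q powr (- (real p * \<delta>))"
      proof -
        have "(real (Suc j ^ p))\<^sup>2 = q powr (real p * 2)"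
          unfolding N using q by (simp add: power2_eq_square powr_add[symmetric] mult.commute)
        moreover have "real (Suc j ^ p) powr (2 - \<delta>) = q powr (real p * (2 - \<delta>))"
          unfolding N by (rule powr_powr)
        moreover have "q powr (real p * (2 - \<delta>)) / q powr (real p * 2) = q powr (- (real p * \<delta>))"
          by (simp add: powr_diff[symmetric] right_diff_distrib)
        ultimately show ?thesis by (metis times_divide_eq_right)
      qed
      also have "\<dots> \<le> C * q powr (- 2)"
        using q p2 C by (intro mult_left_mono powr_mono) auto
      also have "q powr (- 2) = inverse (q ^ 2)" using q by (simp add: powr_minus)
      finally show ?thesis by (simp add: q_def)
    qed
    have "summable (\<lambda>j. inverse (real (Suc j) ^ 2))"
      using inverse_power_summable[of 2, where 'a = real] by (subst summable_Suc_iff) simp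
    then show "summable (\<lambda>j. C * inverse (real (Suc j) ^ 2))" by (rule summable_mult)
  qed
  then show ?thesis using AE_space
  proof eventually_elim
    case (elim x)
    \<comment> \<open>The square root turns the squared average into its absolute value.\<close>
    from elim(1) have "(\<lambda>j. sqrt (W j x)) \<longlonglongrightarrow> sqrt 0" by (rule tendsto_real_sqrt)
    then have "(\<lambda>j. \<bar>(\<Sum>k<Suc j ^ p. Z k x) / real (Suc j ^ p)\<bar>) \<longlonglongrightarrow> 0"
      unfolding W_def by (simp only: real_sqrt_abs real_sqrt_zero)
    then have "(\<lambda>j. (\<Sum>k<Suc j ^ p. Z k x) / real (Suc j ^ p)) \<longlonglongrightarrow> 0"
      by (rule tendsto_rabs_zero_cancel)
    then have "(\<lambda>n. (\<Sum>k<n. Z k x) / real n) \<longlonglongrightarrow> 0"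
      by (rule cesaro_zero_from_powers[OF p Zb[OF elim(2)]])
    then show ?case by (simp add: Z_def)
  qed
qed

section \<open>Measures and continuous functions on I\<close>

lemma space_borel_I [simp]: "space borel_I = {-1..1}"
  by (simp add: borel_I_def space_restrict_space)

lemma space_leb_I [simp]: "space leb_I = {-1..1}"
  by (simp add: leb_I_def space_restrict_space)

lemma sets_leb_I [simp, measurable_cong]: "sets leb_I = sets borel_I"
  by (simp add: leb_I_def borel_I_def sets_restrict_space)

lemma prob_space_leb_I: "prob_space leb_I"
  unfolding leb_I_def
  by (intro prob_space_uniform_measure) (auto simp: emeasure_restrict_space)

lemma C_I_measurable: "f \<in> C_I \<Longrightarrow> f \<in> borel_measurable borel_I"
  unfolding borel_I_def C_I_def by (auto intro: borel_measurable_continuous_on_restrict)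

lemma C_I_bounded:
  assumes "f \<in> C_I"
  obtains B where "\<And>x. x \<in> {-1..1} \<Longrightarrow> \<bar>f x\<bar> \<le> B"
proof -
  have "compact (f ` {-1..1})"
    using assms by (intro compact_continuous_image) (auto simp: C_I_def)
  then have "bounded (f ` {-1..1})" by (rule compact_imp_bounded)
  then obtain B where "\<forall>y\<in>f ` {-1..1}. norm y \<le> B" unfolding bounded_iff by blast
  then show thesis by (intro that[of B]) auto
qed

lemma C_I_integrable:
  assumes "f \<in> C_I" "prob_space \<mu>" "sets \<mu> = sets borel_I"
  shows "integrable \<mu> f"
proof -
  interpret prob_space \<mu> by fact
  obtain B where B: "\<And>x. x \<in> {-1..1} \<Longrightarrow> \<bar>f x\<bar> \<le> B" using C_I_bounded[OF assms(1)] by blast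
  have "space \<mu> = {-1..1}" using sets_eq_imp_space_eq[OF assms(3)] by simp
  moreover have "f \<in> borel_measurable \<mu>"
    using C_I_measurable[OF assms(1)] measurable_cong_sets[OF assms(3) refl] by blast
  ultimately show ?thesis using B by (intro integrable_const_bound[of _ B]) auto
qed

lemma prob_space_nu_star: "prob_space (nu_star g)"
  unfolding nu_star_def by (intro prob_space.prob_space_distr prob_space_measure_pmf) auto

lemma sets_nu_star [simp]: "sets (nu_star g) = sets borel_I"
  by (simp add: nu_star_def)

section \<open>Self-maps of I: measurability and testing orbits on a dense class\<close>

lemma F_star_maps_I:
  assumes "g \<in> F_star"
  shows "g ` {-1..1} \<subseteq> {-1..1}"
  using assms by (auto simp: F_star_def F_star_exponents_def cond_A0_def)

text \<open>Both branches are continuous on their open intervals, and altering a function at the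
  finitely many points -1, 0, 1 preserves Borel measurability.\<close>

lemma F_star_measurable:
  assumes "g \<in> F_star"
  shows "g \<in> borel_I \<rightarrow>\<^sub>M borel_I"
proof -
  have A0: "cond_A0 g" using assms by (auto simp: F_star_def F_star_exponents_def)
  define S :: "real set" where "S = {-1<..<0} \<union> {0<..<1}"
  have "continuous_on S g"
    using A0 unfolding S_def cond_A0_def C2_diffeo_def C2_on_def
    by (auto intro!: continuous_at_imp_continuous_on differentiable_imp_continuous_within)
  then have "(\<lambda>x. indicator S x *\<^sub>R g x) \<in> borel_measurable borel"
    by (intro borel_measurable_continuous_on_indicator) (auto simp: S_def)
  then have "(\<lambda>x. indicator S x *\<^sub>R g x) \<in> borel_measurable borel_I"
    unfolding borel_I_def by (rule measurable_restrict_space1)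
  then have "g \<in> borel_measurable borel_I"
  proof (rule measurable_discrete_difference)
    show "countable {-1, 0, 1 :: real}" by simp
    show "{x} \<in> sets borel_I" if "x \<in> {-1, 0, 1}" for x
      using that by (auto simp: borel_I_def sets_restrict_space_iff)
    show "indicator S x *\<^sub>R g x = g x" if "x \<in> space borel_I" "x \<notin> {-1, 0, 1}" for x
      using that by (auto simp: S_def indicator_def)
  qed auto
  then show ?thesis
    unfolding borel_I_def using F_star_maps_I[OF assms]
    by (intro measurable_restrict_space2) (auto simp: space_restrict_space)
qed

text \<open>For \<open>n = 0\<close> the measure \<open>mu_dyad g x n\<close> is null, and the mean \<open>0 / 0 = 0\<close> agrees with its
  integral.\<close>

lemma weak_star_conv_mu_dyad_dense:
  assumes g: "g ` {-1..1} \<subseteq> {-1..1}" and x: "x \<in> {-1..1}"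
    and \<nu>: "prob_space \<nu>" "sets \<nu> = sets borel_I"
    and D: "D \<subseteq> C_I" "uniformly_dense D"
    and conv: "\<And>\<phi>. \<phi> \<in> D \<Longrightarrow>
      (\<lambda>n. (\<Sum>k<n. \<phi> ((g ^^ (2 ^ k)) x)) / real n) \<longlonglongrightarrow> (\<integral>y. \<phi> y \<partial>\<nu>)"
  shows "weak_star_conv (mu_dyad g x) \<nu>"
  unfolding weak_star_conv_def
proof (intro ballI)
  fix f assume f: "f \<in> C_I"
  interpret \<nu>: prob_space \<nu> by fact
  have orb: "(g ^^ k) x \<in> {-1..1}" for k
    using g x by (induction k) (auto simp: image_subset_iff simp del: atLeastAtMost_iff)
  have "(\<lambda>n. (\<Sum>k<n. f ((g ^^ (2 ^ k)) x)) / real n) \<longlonglongrightarrow> (\<integral>y. f y \<partial>\<nu>)"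
  proof (rule LIMSEQ_I)
    \<comment> \<open>Three errors of size r / 3: uniform closeness of \<open>d\<close> to
      \<open>f\<close> controls both the orbit average (every orbit point stays in I) and the
      integral against \<open>\<nu>\<close>, and \<open>conv\<close> handles
      \<open>d\<close>.\<close>
    fix r :: real assume "r > 0"
    then obtain d where d: "d \<in> D" "\<And>y. y \<in> {-1..1} \<Longrightarrow> \<bar>f y - d y\<bar> < r / 3"
      using D(2) f unfolding uniformly_dense_def by (metis divide_pos_pos zero_less_numeral)
    have dC: "d \<in> C_I" using d D by auto
    obtain N where N: "\<And>n. n \<ge> N \<Longrightarrow>
        \<bar>(\<Sum>k<n. d ((g ^^ (2 ^ k)) x)) / real n - (\<integral>y. d y \<partial>\<nu>)\<bar> < r / 3"
      using LIMSEQ_D[OF conv[OF d(1)], of "r / 3"] \<open>r > 0\<close> by auto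
    have int: "integrable \<nu> f" "integrable \<nu> d" using f dC \<nu> by (auto intro: C_I_integrable)
    have sp: "space \<nu> = {-1..1}" using sets_eq_imp_space_eq[OF \<nu>(2)] by simp
    have "\<bar>(\<integral>y. f y \<partial>\<nu>) - (\<integral>y. d y \<partial>\<nu>)\<bar> = \<bar>\<integral>y. f y - d y \<partial>\<nu>\<bar>" using int by simp
    also have "\<dots> \<le> (\<integral>y. \<bar>f y - d y\<bar> \<partial>\<nu>)" by (rule integral_abs_bound)
    also have "\<dots> \<le> (\<integral>y. r / 3 \<partial>\<nu>)"
      using int d(2) sp by (intro integral_mono) (auto intro: less_imp_le)
    finally have 1: "\<bar>(\<integral>y. f y \<partial>\<nu>) - (\<integral>y. d y \<partial>\<nu>)\<bar> \<le> r / 3" by (simp add: \<nu>.prob_space)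
    have 2: "\<bar>(\<Sum>k<n. f ((g ^^ (2 ^ k)) x)) / real n - (\<Sum>k<n. d ((g ^^ (2 ^ k)) x)) / real n\<bar>
        \<le> r / 3" if "n > 0" for n
    proof -
      have "\<bar>\<Sum>k<n. f ((g ^^ (2 ^ k)) x) - d ((g ^^ (2 ^ k)) x)\<bar> \<le> (\<Sum>k<n. r / 3)"
        using d(2) orb by (intro order_trans[OF sum_abs] sum_mono) (auto intro: less_imp_le)
      then show ?thesis
        using that by (simp add: sum_subtractf diff_divide_distrib[symmetric] field_simps)
    qed
    show "\<exists>no. \<forall>n\<ge>no. norm ((\<Sum>k<n. f ((g ^^ (2 ^ k)) x)) / real n - (\<integral>y. f y \<partial>\<nu>)) < r"
    proof (intro exI[of _ "Suc N"] allI impI)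
      fix n assume n: "n \<ge> Suc N"
      show "norm ((\<Sum>k<n. f ((g ^^ (2 ^ k)) x)) / real n - (\<integral>y. f y \<partial>\<nu>)) < r"
        using 1 2[of n] N[of n] n unfolding real_norm_def by linarith
    qed
  qed
  then show "(\<lambda>n. \<integral>y. f y \<partial>mu_dyad g x n) \<longlonglongrightarrow> (\<integral>y. f y \<partial>\<nu>)"
    by (simp add: integral_mu_dyad[OF f g x])
qed

section \<open>Convergence of the dyadic empirical measures\<close>

theorem corollary5p5:
  fixes g :: "real \<Rightarrow> real" and D :: "(real \<Rightarrow> real) set"
  assumes "g \<in> F_star" and "SNM g"
    and "D \<subseteq> C_I" and "countable D" and "uniformly_dense D"
    and "\<And>\<phi>. \<phi> \<in> D \<Longrightarrow> \<exists>C::real. \<exists>\<delta>>0. \<forall>n\<ge>1.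
           (\<Sum>i<n. \<Sum>j<n. \<bar>Cov_I (\<phi> \<circ> (g ^^ (2 ^ i))) (\<phi> \<circ> (g ^^ (2 ^ j)))\<bar>)
             \<le> C * real n powr (2 - \<delta>)"
  shows "(AE x in leb_I. weak_star_conv (mu_dyad g x) (nu_star g)) \<and>
         X_dyad g \<in> null_sets (completion leb_I)"
proof
  interpret prob_space leb_I by (rule prob_space_leb_I)
  have gI: "g ` {-1..1} \<subseteq> {-1..1}" by (rule F_star_maps_I[OF assms(1)])
  have gk: "(g ^^ k) \<in> borel_I \<rightarrow>\<^sub>M borel_I" for k
    using F_star_measurable[OF assms(1)] by (rule measurable_compose_n)
  have gk': "(g ^^ k) \<in> leb_I \<rightarrow>\<^sub>M borel_I" for k
    using gk[of k] by (simp cong: measurable_cong_sets)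
  have orb: "(g ^^ k) x \<in> {-1..1}" if "x \<in> {-1..1}" for k x
    using measurable_space[OF gk] that by simp
  have "AE x in leb_I. (\<lambda>n. (\<Sum>k<n. \<phi> ((g ^^ (2 ^ k)) x)) / real n) \<longlonglongrightarrow> (\<integral>y. \<phi> y \<partial>nu_star g)"
    if \<phi>D: "\<phi> \<in> D" for \<phi>
  proof -
    have \<phi>: "\<phi> \<in> C_I" using \<phi>D assms(3) by auto
    have \<phi>m: "\<phi> \<in> borel_measurable borel_I" by (rule C_I_measurable[OF \<phi>])
    obtain B where B: "\<And>x. x \<in> {-1..1} \<Longrightarrow> \<bar>\<phi> x\<bar> \<le> B" using C_I_bounded[OF \<phi>] by blast
    obtain C \<delta> where C: "\<delta> > 0" "\<And>n. n \<ge> 1 \<Longrightarrow>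
        (\<Sum>i<n. \<Sum>j<n. \<bar>Cov_I (\<phi> \<circ> (g ^^ (2 ^ i))) (\<phi> \<circ> (g ^^ (2 ^ j)))\<bar>)
             \<le> C * real n powr (2 - \<delta>)"
      using assms(6)[OF \<phi>D] by blast
    define Y where "Y k x = \<phi> ((g ^^ (2 ^ k)) x)" for k x
    have Ym: "Y k \<in> borel_measurable leb_I" for k
      unfolding Y_def by (rule measurable_compose[OF gk' \<phi>m])
    have EY: "expectation (Y k) = (\<integral>y. \<phi> y \<partial>distr leb_I borel_I (g ^^ (2 ^ k)))" for k
      unfolding Y_def by (rule integral_distr[OF gk' \<phi>m, symmetric])
    have "weak_star_conv (\<lambda>n. distr leb_I borel_I (g ^^ n)) (nu_star g)"
      using assms(2) prob_space_leb_I by (simp add: SNM_def absolutely_continuous_def)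
    then have "(\<lambda>n. \<integral>y. \<phi> y \<partial>distr leb_I borel_I (g ^^ n)) \<longlonglongrightarrow> (\<integral>y. \<phi> y \<partial>nu_star g)"
      using \<phi> by (simp add: weak_star_conv_def)
    \<comment> \<open>The indices 2^k are strictly increasing, so the limit along all iterates
      passes to this subsequence.\<close>
    then have "(\<lambda>k. expectation (Y k)) \<longlonglongrightarrow> (\<integral>y. \<phi> y \<partial>nu_star g)"
      unfolding EY
      by (rule filterlim_compose) (simp add: filterlim_subseq strict_mono_def)
    then have means: "(\<lambda>n. (\<Sum>k<n. expectation (Y k)) / real n) \<longlonglongrightarrow> (\<integral>y. \<phi> y \<partial>nu_star g)"
      by (rule cesaro_mean_tendsto)
    have "AE x in leb_I. (\<lambda>n. (\<Sum>k<n. Y k x - expectation (Y k)) / real n) \<longlonglongrightarrow> 0"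
    proof (rule AE_centered_means_tendsto_zero[OF Ym _ C(1)])
      show "\<bar>Y k x\<bar> \<le> B" if "x \<in> space leb_I" for k x
        unfolding Y_def using that by (intro B orb) simp
      show "(\<Sum>i<n. \<Sum>j<n. \<bar>expectation (\<lambda>x. Y i x * Y j x) - expectation (Y i) * expectation (Y j)\<bar>)
        \<le> C * real n powr (2 - \<delta>)" if "n \<ge> 1" for n
        using C(2)[OF that] by (simp add: Cov_I_def Y_def[abs_def] comp_def)
    qed
    then show ?thesis
    proof eventually_elim
      case (elim x)
      \<comment> \<open>Adding the averaged expectations back removes the centering.\<close>
      from tendsto_add[OF elim means] show ?case
        by (simp add: sum_subtractf add_divide_distrib[symmetric] Y_def)
    qed
  qed
  \<comment> \<open>Countability of \<open>D\<close> lets the exceptional null sets of the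
    individual \<open>\<phi>\<close> be merged into one.\<close>
  then have "AE x in leb_I. \<forall>\<phi>\<in>D.
      (\<lambda>n. (\<Sum>k<n. \<phi> ((g ^^ (2 ^ k)) x)) / real n) \<longlonglongrightarrow> (\<integral>y. \<phi> y \<partial>nu_star g)"
    using assms(4) by (simp add: AE_ball_countable)
  then show AE: "AE x in leb_I. weak_star_conv (mu_dyad g x) (nu_star g)"
    using AE_space
  proof eventually_elim
    case (elim x)
    then show ?case
      by (intro weak_star_conv_mu_dyad_dense[OF gI _ prob_space_nu_star sets_nu_star assms(3,5)]) auto
  qed
  \<comment> \<open>Outside \<open>N\<close> the measures converge to \<open>nu_star g\<close>, a
    probability measure, so \<open>X_dyad g\<close> lies inside the Borel null set \<open>N\<close>;
    as a subset of it, \<open>X_dyad g\<close> is null for the completed measure.\<close>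
  obtain N where N: "N \<in> null_sets leb_I"
    "{x \<in> space leb_I. \<not> weak_star_conv (mu_dyad g x) (nu_star g)} \<subseteq> N"
    using AE by (rule AE_E3) blast
  have "X_dyad g \<subseteq> N"
    using N(2) prob_space_nu_star[of g] sets_nu_star[of g] by (auto simp: X_dyad_def)
  then show "X_dyad g \<in> null_sets (completion leb_I)"
    using N(1) null_sets_completion_subset null_sets_completionI by blast
qed

end
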